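(* Let $(\sigma_k)_{k\in\mathbb{N}_0}\in\{\pm1\}^{\mathbb{N}_0}$ be an arbitrary sequence of signs, and define polynomials $P_k,Q_k$ ($k\in\mathbb{N}_0$) by $P_0(x)=Q_0(x)=x$ and $$P_{k+1}(x)=P_k(x)+\sigma_k\,x^{2^k}Q_k(x),\qquad Q_{k+1}(x)=P_k(x)-\sigma_k\,x^{2^k}Q_k(x).$$ Let $(\varepsilon_n)_{n\in\mathbb{N}}\in\{\pm1\}^{\mathbb{N}}$ be the sequence determined by $P_k(x)=\sum_{n=1}^{2^k}\varepsilon_n x^n$ for all $k\in\mathbb{N}_0$. Then the weighted Dirac comb $\sum_{n\in\mathbb{N}}\varepsilon_n\delta_n$ has purely absolutely continuous diffraction.
   Context: $\mathbb{N}=\{1,2,3,\dots\}$, $\mathbb{N}_0=\mathbb{N}\cup\{0\}$, and $\delta_n$ is the unit point mass at $n\in\mathbb{R}$. The sequence $(\varepsilon_n)$ is well defined because the terms of $P_{k+1}$ of degree at most $2^k$ coincide with those of $P_k$. Diffraction: for a bounded complex sequence $(\varepsilon_n)_{n\in\mathbb{N}}$ put $\mu_N=\sum_{n=1}^{N}\varepsilon_n\delta_n$ and $\widetilde{\mu_N}=\sum_{n=1}^{N}\overline{\varepsilon_n}\,\delta_{-n}$ (complex conjugation). An autocorrelation of the Dirac comb $\sum_{n\in\mathbb{N}}\varepsilon_n\delta_n$ is a vague accumulation point $\gamma$, as $N\to\infty$, of the measures $\frac1N\,\mu_N*\widetilde{\mu_N}$ on $\mathbb{R}$ (the autocorrelation,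 if the limit exists). The corresponding diffraction measure is the Fourier transform $\widehat{\gamma}$, a positive measure on $\mathbb{R}$; equivalently, it is the corresponding vague accumulation point of the measures $\frac1N\bigl|\sum_{n=1}^{N}\varepsilon_n e^{-2\pi\mathrm{i}nt}\bigr|^2\,dt$. The comb has purely absolutely continuous diffraction if $\widehat{\gamma}$ is absolutely continuous with respect to Lebesgue measure (for every such $\gamma$). *)

theory Defs
  imports "HOL-Analysis.Analysis" "HOL-Computational_Algebra.Polynomial"
begin

definition Cc :: "(real \<Rightarrow> complex) set" where
  "Cc = {f. continuous_on UNIV f \<and> compact (closure {x. f x \<noteq> 0})}"

text \<open>
  A (possibly unbounded) complex Radon measure on the line is given, as in Bourbaki, by the linear
  functional that it induces on \<^term>\<open>Cc\<close>. Only the values on \<^term>\<open>Cc\<close> are meaningful.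
\<close>

type_synonym functional = "(real \<Rightarrow> complex) \<Rightarrow> complex"

definition complex_radon_measure :: "functional \<Rightarrow> bool" where
  "complex_radon_measure \<mu> \<longleftrightarrow>
     (\<forall>f\<in>Cc. \<forall>g\<in>Cc. \<mu> (\<lambda>x. f x + g x) = \<mu> f + \<mu> g) \<and>
     (\<forall>c. \<forall>f\<in>Cc. \<mu> (\<lambda>x. c * f x) = c * \<mu> f) \<and>
     (\<forall>K. compact K \<longrightarrow>
        (\<exists>C. \<forall>f\<in>Cc. (\<forall>x. x \<notin> K \<longrightarrow> f x = 0) \<longrightarrow> norm (\<mu> f) \<le> C * (SUP x. norm (f x))))"

definition point_mass :: "real \<Rightarrow> functional" where
  "point_mass a = (\<lambda>f. f a)"

text \<open>Convolution; used only for measures of finite support.\<close>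

definition measure_conv :: "functional \<Rightarrow> functional \<Rightarrow> functional" where
  "measure_conv \<mu> \<nu> = (\<lambda>f. \<mu> (\<lambda>x. \<nu> (\<lambda>y. f (x + y))))"

definition finite_comb :: "(nat \<Rightarrow> complex) \<Rightarrow> nat \<Rightarrow> functional" where
  "finite_comb c N = (\<lambda>f. \<Sum>n=1..N. c n * point_mass (real n) f)"

definition finite_comb_tilde :: "(nat \<Rightarrow> complex) \<Rightarrow> nat \<Rightarrow> functional" where
  "finite_comb_tilde c N = (\<lambda>f. \<Sum>n=1..N. cnj (c n) * point_mass (- real n) f)"

definition finite_autocorrelation :: "(nat \<Rightarrow> complex) \<Rightarrow> nat \<Rightarrow> functional" where
  "finite_autocorrelation c N =
     (\<lambda>f. 1 / of_nat N * measure_conv (finite_comb c N) (finite_comb_tilde c N) f)"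

text \<open>
  The vague topology is that of pointwise convergence on \<^term>\<open>Cc\<close>. Its basic neighbourhoods are
  given by a finite set of test functions and a tolerance, and an accumulation point is a measure
  each of whose neighbourhoods contains terms of the sequence with arbitrarily large index.
\<close>

definition vague_accumulation_point :: "(nat \<Rightarrow> functional) \<Rightarrow> functional \<Rightarrow> bool" where
  "vague_accumulation_point \<mu> \<gamma> \<longleftrightarrow>
     complex_radon_measure \<gamma> \<and>
     (\<forall>F e. finite F \<longrightarrow> F \<subseteq> Cc \<longrightarrow> e > 0 \<longrightarrow>
        (\<exists>\<^sub>F N in sequentially. \<forall>f\<in>F. norm (\<mu> N f - \<gamma> f) < e))"

definition is_autocorrelation :: "(nat \<Rightarrow> complex) \<Rightarrow> functional \<Rightarrow> bool" where
  "is_autocorrelation c \<gamma> \<longleftrightarrow> vague_accumulation_point (finite_autocorrelation c) \<gamma>"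

definition fun_conv :: "(real \<Rightarrow> complex) \<Rightarrow> (real \<Rightarrow> complex) \<Rightarrow> real \<Rightarrow> complex" where
  "fun_conv f g x = (LINT y|lborel. f y * g (x - y))"

definition fun_tilde :: "(real \<Rightarrow> complex) \<Rightarrow> real \<Rightarrow> complex" where
  "fun_tilde f x = cnj (f (- x))"

definition inv_fourier :: "(real \<Rightarrow> complex) \<Rightarrow> real \<Rightarrow> complex" where
  "inv_fourier f t = (LINT x|lborel. exp (2 * of_real pi * \<i> * of_real (x * t)) * f x)"

text \<open>
  Fourier transform of a possibly unbounded measure, after Argabright and Gil de Lamadrid
  (for positive definite measures: Bochner--Schwartz, Berg--Forst): a measure \<open>\<nu>\<close> is the transform
  of \<open>\<gamma>\<close> if \<open>\<gamma>\<close> paired with \<open>f * f~\<close> equals \<open>\<nu>\<close> paired with the squared modulus of the inverse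
  transform of \<open>f\<close>, for all \<open>f\<close> in \<^term>\<open>Cc\<close>. The kernel of the transform is \<open>exp (-2 pi i x t)\<close>. As
  diffraction measures are positive, \<open>\<nu>\<close> ranges over the positive locally finite Borel measures.
\<close>

definition is_fourier_transform :: "functional \<Rightarrow> real measure \<Rightarrow> bool" where
  "is_fourier_transform \<gamma> \<nu> \<longleftrightarrow>
     sets \<nu> = sets borel \<and>
     (\<forall>K. compact K \<longrightarrow> emeasure \<nu> K < \<infinity>) \<and>
     (\<forall>f\<in>Cc. integrable \<nu> (\<lambda>t. (norm (inv_fourier f t))\<^sup>2) \<and>
        \<gamma> (fun_conv f (fun_tilde f)) = of_real (LINT t|\<nu>. (norm (inv_fourier f t))\<^sup>2))"

text \<open>
  The value \<open>c 0\<close> plays no role. The existence clause excludes that the condition holds vacuously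
  because some autocorrelation has no positive measure as its Fourier transform.
\<close>

definition purely_ac_diffraction :: "(nat \<Rightarrow> complex) \<Rightarrow> bool" where
  "purely_ac_diffraction c \<longleftrightarrow>
     (\<forall>\<gamma>. is_autocorrelation c \<gamma> \<longrightarrow>
        (\<exists>\<nu>. is_fourier_transform \<gamma> \<nu>) \<and>
        (\<forall>\<nu>. is_fourier_transform \<gamma> \<nu> \<longrightarrow> absolutely_continuous lborel \<nu>))"

end

theory Submission
  imports Defs "HOL-Probability.Probability"
begin


text \<open>
  The autocorrelation of the comb is \<open>\<delta>\<^sub>0\<close>, so its diffraction is Lebesgue measure. There are two
  independent parts.

  Combinatorics. Cut the sequence into blocks of length \<open>2\<^sup>k\<close>. Each block is, up to sign, the
  coefficient sequence of \<open>P\<^sub>k\<close> or of \<open>Q\<^sub>k\<close> (\<open>rs_block\<close>). For every weight \<open>g\<close> of finite support with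
  \<open>g 0 = 0\<close> the \<open>g\<close>-weighted correlations within these two blocks add up to zero; this is the
  identity \<open>\<bar>P\<^sub>k\<bar>\<^sup>2 + \<bar>Q\<^sub>k\<bar>\<^sup>2 = 2\<^bsup>k+1\<^esup>\<close> on the unit circle, read off coefficientwise. Since \<open>P\<^bsub>k+1\<^esub>\<close>
  is the concatenation of \<open>P\<^sub>k\<close> and \<open>\<plusminus> Q\<^sub>k\<close>, only the pairs across the junction survive, and a weight
  of finite support sees a bounded number of these. So each block contributes an amount bounded
  independently of \<open>k\<close>, and so does each junction of blocks. The correlation up to \<open>N\<close> is therefore
  at most a constant times \<open>N / 2\<^sup>k + 2\<^sup>k\<close> for every \<open>k\<close>, which is \<open>o(N)\<close>
  (\<open>rs_window_corr_tendsto_0\<close>). Taking for \<open>g\<close> a test function restricted to the nonzero integers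
  shows that the finite autocorrelations converge vaguely to \<open>\<delta>\<^sub>0\<close>.

  Fourier analysis. That Lebesgue measure is a transform of \<open>\<delta>\<^sub>0\<close> is Plancherel's identity on \<open>Cc\<close>,
  that is, Fourier inversion at the origin for \<open>f * f~\<close>; Gaussian damping proves it
  (\<open>fourier_inversion_at_0\<close>). That every other transform \<open>\<nu>\<close> is absolutely continuous as well follows
  from a uniqueness argument: translating \<open>f\<close> modulates its transform, so the defining equation
  determines the characteristic function of the finite measure \<open>\<bar>f^\<bar>\<^sup>2 \<nu>\<close>, and by Levy's uniqueness
  theorem the measure itself (\<open>fourier_transform_density_unique\<close>). As \<open>f\<close> varies, the functions \<open>f^\<close>
  have no common zero, which carries null sets of one transform to null sets of the other.
\<close>

section \<open>Correlations in a finite window\<close>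

definition window_corr :: "(int \<Rightarrow> complex) \<Rightarrow> (nat \<Rightarrow> complex) \<Rightarrow> nat \<Rightarrow> complex" where
  "window_corr g a n = (\<Sum>i<n. \<Sum>j<n. a i * a j * g (int i - int j))"

text \<open>
  The part of the correlation of the first \<open>m + n\<close> terms that couples the first \<open>m\<close> of them to the
  remaining \<open>n\<close>, in both orders.
\<close>

definition cross_corr :: "(int \<Rightarrow> complex) \<Rightarrow> (nat \<Rightarrow> complex) \<Rightarrow> nat \<Rightarrow> nat \<Rightarrow> complex" where
  "cross_corr g a m n =
     (\<Sum>i<m. \<Sum>j<n. a i * a (m + j) * (g (int i - int (m + j)) + g (int (m + j) - int i)))"

lemma sum_lessThan_add:
  fixes f :: "nat \<Rightarrow> 'a::comm_monoid_add"
  shows "(\<Sum>i<m + n. f i) = (\<Sum>i<m. f i) + (\<Sum>j<n. f (m + j))"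
  by (induction n) (auto simp: add.assoc)

lemma window_corr_add:
  "window_corr g a (m + n) =
     window_corr g a m + window_corr g (\<lambda>r. a (m + r)) n + cross_corr g a m n"
proof -
  have "(\<Sum>j<n. \<Sum>i<m. a (m + j) * a i * g (int (m + j) - int i)) =
        (\<Sum>i<m. \<Sum>j<n. a i * a (m + j) * g (int (m + j) - int i))"
    by (subst sum.swap) (simp add: mult.commute)
  then show ?thesis
    unfolding window_corr_def cross_corr_def
    by (simp add: sum_lessThan_add sum.distrib algebra_simps)
qed

lemma window_corr_cong:
  assumes "\<And>r. r < n \<Longrightarrow> a r = b r"
  shows "window_corr g a n = window_corr g b n"
  unfolding window_corr_def using assms by (intro sum.cong refl) auto

lemma window_corr_sign:
  assumes "s \<in> {1, -1::complex}" and "\<And>r. r < n \<Longrightarrow> a r = s * b r"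
  shows "window_corr g a n = window_corr g b n"
  unfolding window_corr_def using assms by (intro sum.cong refl) auto

text \<open>
  Only pairs at distance less than \<open>D\<close> count, and across a junction there are at most \<open>D\<^sup>2\<close> of these,
  however long the two sides are.
\<close>

lemma norm_cross_corr_le:
  assumes "\<And>n. norm (a n) \<le> 1" and "\<And>z. norm (g z) \<le> B"
    and supp: "\<And>z. \<bar>z\<bar> \<ge> int D \<Longrightarrow> g z = 0"
  shows "norm (cross_corr g a m n) \<le> 2 * B * real D ^ 2"
proof -
  have B: "B \<ge> 0" using norm_ge_zero order_trans assms(2) by blast
  define t where "t = (\<lambda>(i, j). a i * a (m + j) * (g (int i - int (m + j)) + g (int (m + j) - int i)))"
  let ?S = "{m - D..<m} \<times> {..<D}"
  have "cross_corr g a m n = (\<Sum>p\<in>{..<m} \<times> {..<n}. t p)"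
    unfolding cross_corr_def t_def by (simp add: sum.cartesian_product)
  also have "\<dots> = (\<Sum>p\<in>({..<m} \<times> {..<n}) \<inter> ?S. t p)"
  proof (rule sum.mono_neutral_right)
    show "\<forall>p\<in>{..<m} \<times> {..<n} - {..<m} \<times> {..<n} \<inter> ?S. t p = 0"
    proof
      fix p assume p: "p \<in> {..<m} \<times> {..<n} - {..<m} \<times> {..<n} \<inter> ?S"
      obtain i j where ij: "p = (i, j)" by fastforce
      have "int m + int j - int i \<ge> int D" using p ij by auto
      then have "g (int i - int (m + j)) = 0" "g (int (m + j) - int i) = 0"
        by (auto intro!: supp)
      then show "t p = 0" by (simp add: t_def ij)
    qed
  qed auto
  finally have eq: "cross_corr g a m n = (\<Sum>p\<in>({..<m} \<times> {..<n}) \<inter> ?S. t p)" .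
  have "norm (t p) \<le> 2 * B" for p
  proof -
    obtain i j where ij: "p = (i, j)" by fastforce
    have "norm (t p) = norm (a i) * norm (a (m + j)) * norm (g (int i - int (m + j)) + g (int (m + j) - int i))"
      by (simp add: t_def ij norm_mult)
    also have "\<dots> \<le> 1 * 1 * (B + B)"
      by (intro mult_mono norm_triangle_mono assms) auto
    finally show ?thesis by simp
  qed
  then have "norm (cross_corr g a m n) \<le> real (card (({..<m} \<times> {..<n}) \<inter> ?S)) * (2 * B)"
    unfolding eq by (intro sum_norm_bound) auto
  also have "\<dots> \<le> real (D * D) * (2 * B)"
  proof (intro mult_right_mono of_nat_mono)
    have "card (({..<m} \<times> {..<n}) \<inter> ?S) \<le> card ?S" by (intro card_mono) auto
    also have "\<dots> = (m - (m - D)) * D" by (simp add: card_cartesian_product)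
    also have "\<dots> \<le> D * D" by (intro mult_right_mono) auto
    finally show "card (({..<m} \<times> {..<n}) \<inter> ?S) \<le> D * D" .
  qed (use B in auto)
  finally show ?thesis by (simp add: power2_eq_square mult_ac)
qed

section \<open>Rudin--Shapiro sequences with arbitrary signs\<close>

text \<open>
  For \<open>j < 2\<^sup>k\<close> this is the coefficient of \<open>x\<^bsup>j+1\<^esup>\<close> in \<open>Q\<^sub>k\<close>, where \<open>a j\<close> is that in \<open>P\<^sub>k\<close>: the two
  polynomials agree on the first half of their terms and are opposite on the second half. The test
  \<open>2 * j < 2 ^ k\<close> puts the single term of \<open>P\<^sub>0 = Q\<^sub>0\<close> into the first half.
\<close>

definition rs_partner :: "(nat \<Rightarrow> complex) \<Rightarrow> nat \<Rightarrow> nat \<Rightarrow> complex" where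
  "rs_partner a k j = (if 2 * j < 2 ^ k then a j else - a j)"

text \<open>
  The polynomial recursion in terms of coefficients; the index is shifted, so that \<open>a n\<close> stands for
  \<open>\<epsilon>\<^bsub>n+1\<^esub>\<close> and the block of \<open>P\<^sub>k\<close> is \<open>{0..<2\<^sup>k}\<close>.
\<close>

definition rs_sequence :: "(nat \<Rightarrow> complex) \<Rightarrow> (nat \<Rightarrow> complex) \<Rightarrow> bool" where
  "rs_sequence s a \<longleftrightarrow> (\<forall>k. s k \<in> {1, -1}) \<and> (\<forall>n. a n \<in> {1, -1}) \<and>
     (\<forall>k j. j < 2 ^ k \<longrightarrow> a (2 ^ k + j) = s k * rs_partner a k j)"

text \<open>
  Induction on the block number: removing the leading binary digit \<open>2\<^sup>l\<close> of \<open>q\<close> multiplies \<open>a\<close> by a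
  sign that depends, for \<open>l > 0\<close>, on the next digit of \<open>q\<close> only and hence is constant on the block.
  For \<open>q = 1\<close> the next digit belongs to the position within the block, and \<open>Q\<^sub>k\<close> appears.
\<close>

lemma rs_block:
  assumes "rs_sequence s a"
  shows "\<exists>u\<in>{1, -1}. (\<forall>r<2 ^ k. a (2 ^ k * q + r) = u * a r) \<or>
                        (\<forall>r<2 ^ k. a (2 ^ k * q + r) = u * rs_partner a k r)"
proof (induction q rule: less_induct)
  case (less q)
  have s: "s l \<in> {1, -1}" for l using assms by (auto simp: rs_sequence_def)
  have rec: "a (2 ^ l + j) = s l * rs_partner a l j" if "j < 2 ^ l" for l j
    using assms that by (auto simp: rs_sequence_def)
  show ?case
  proof (cases "q = 0")
    case True
    then show ?thesis by auto
  next
    case False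
    then obtain l where l: "2 ^ l \<le> q" "q < 2 ^ Suc l"
      using ex_power_ivl1[of 2 q] by auto
    define p where "p = q - 2 ^ l"
    have q: "q = 2 ^ l + p" and p: "p < 2 ^ l" using l by (auto simp: p_def)
    have idx: "2 ^ k * q + r = 2 ^ (k + l) + (2 ^ k * p + r)" for r
      by (simp add: q algebra_simps power_add)
    have small: "2 ^ k * p + r < 2 ^ (k + l)" if "r < 2 ^ k" for r
    proof -
      have "2 ^ k * p + r < 2 ^ k * (p + 1)" using that by simp
      also have "\<dots> \<le> 2 ^ k * 2 ^ l" using p by (intro mult_left_mono) auto
      finally show ?thesis by (simp add: power_add)
    qed
    have a: "a (2 ^ k * q + r) = s (k + l) * rs_partner a (k + l) (2 ^ k * p + r)"
      if "r < 2 ^ k" for r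
      using rec[OF small[OF that]] by (simp add: idx)
    show ?thesis
    proof (cases l)
      case 0
      then have "\<forall>r<2 ^ k. a (2 ^ k * q + r) = s k * rs_partner a k r" using a p by simp
      then show ?thesis using s[of k] by blast
    next
      case (Suc l')
      define v where "v = (if p < 2 ^ l' then 1 else -1 :: complex)"
      have v: "v \<in> {1, -1}" by (simp add: v_def)
      have part: "rs_partner a (k + l) (2 ^ k * p + r) = v * a (2 ^ k * p + r)" if r: "r < 2 ^ k" for r
      proof -
        have "2 ^ k * p + r < 2 ^ k * 2 ^ l' \<longleftrightarrow> p < 2 ^ l'"
        proof
          assume "p < 2 ^ l'"
          then have "2 ^ k * (p + 1) \<le> (2 ^ k * 2 ^ l' :: nat)" by (intro mult_left_mono) auto
          then show "2 ^ k * p + r < 2 ^ k * 2 ^ l'" using r by simp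
        next
          assume "2 ^ k * p + r < 2 ^ k * 2 ^ l'"
          then have "2 ^ k * p < (2 ^ k * 2 ^ l' :: nat)" by linarith
          then show "p < 2 ^ l'" by simp
        qed
        moreover have "2 ^ (k + l) = (2 * (2 ^ k * 2 ^ l') :: nat)" by (simp add: Suc power_add)
        ultimately have "2 * (2 ^ k * p + r) < 2 ^ (k + l) \<longleftrightarrow> p < 2 ^ l'"
          by (simp only: mult_less_cancel1) simp
        then show ?thesis unfolding rs_partner_def v_def by simp
      qed
      have "p < q" by (simp add: q)
      from less.IH[OF this] obtain u where u: "u \<in> {1, -1}" and
        "(\<forall>r<2 ^ k. a (2 ^ k * p + r) = u * a r) \<or>
         (\<forall>r<2 ^ k. a (2 ^ k * p + r) = u * rs_partner a k r)"
        by blast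
      then have "(\<forall>r<2 ^ k. a (2 ^ k * q + r) = (s (k + l) * v * u) * a r) \<or>
                 (\<forall>r<2 ^ k. a (2 ^ k * q + r) = (s (k + l) * v * u) * rs_partner a k r)"
        using a part by auto
      moreover have "s (k + l) * v * u \<in> {1, -1}" using s[of "k + l"] v u by auto
      ultimately show ?thesis by blast
    qed
  qed
qed

text \<open>
  In passing from \<open>k\<close> to \<open>k + 1\<close> both correlations become the sum of the two old ones plus the
  contribution of the junction, which enters with opposite signs. So the sum of the two stays zero,
  and each of them equals a single junction term up to sign.
\<close>

lemma rs_window_corr_partner:
  assumes rs: "rs_sequence s a" and g0: "g 0 = 0"
    and K: "\<And>b m n. (\<And>n. norm (b n) \<le> 1) \<Longrightarrow> norm (cross_corr g b m n) \<le> K"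
  shows "window_corr g a (2 ^ k) + window_corr g (rs_partner a k) (2 ^ k) = 0 \<and>
         norm (window_corr g a (2 ^ k)) \<le> K"
proof (induction k)
  case 0
  have "K \<ge> 0" using K[of "\<lambda>_. 0" 0 0] by (simp add: cross_corr_def)
  then show ?case using g0 by (simp add: window_corr_def)
next
  case (Suc k)
  let ?b = "rs_partner a (Suc k)"
  have a1: "a n \<in> {1, -1}" for n using rs by (auto simp: rs_sequence_def)
  have tail: "window_corr g (\<lambda>r. a (2 ^ k + r)) (2 ^ k) = window_corr g (rs_partner a k) (2 ^ k)"
    using rs by (intro window_corr_sign[of "s k"]) (auto simp: rs_sequence_def)
  have btail: "window_corr g (\<lambda>r. ?b (2 ^ k + r)) (2 ^ k) = window_corr g (\<lambda>r. a (2 ^ k + r)) (2 ^ k)"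
    by (intro window_corr_sign[of "-1"]) (auto simp: rs_partner_def)
  have bhead: "window_corr g ?b (2 ^ k) = window_corr g a (2 ^ k)"
    by (intro window_corr_cong) (auto simp: rs_partner_def)
  have bcross: "cross_corr g ?b (2 ^ k) (2 ^ k) = - cross_corr g a (2 ^ k) (2 ^ k)"
    unfolding cross_corr_def sum_negf[symmetric]
    by (intro sum.cong refl) (auto simp: rs_partner_def)
  have two: "(2::nat) ^ Suc k = 2 ^ k + 2 ^ k" by simp
  have A: "window_corr g a (2 ^ Suc k) = cross_corr g a (2 ^ k) (2 ^ k)"
    unfolding two window_corr_add tail using Suc.IH by simp
  have B: "window_corr g ?b (2 ^ Suc k) = - cross_corr g a (2 ^ k) (2 ^ k)"
    unfolding two window_corr_add
    unfolding two[symmetric] btail bhead bcross tail using Suc.IH by simp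
  have "norm (a n) \<le> 1" for n using a1[of n] by auto
  then have "norm (cross_corr g a (2 ^ k) (2 ^ k)) \<le> K" by (rule K)
  then show ?case using A B by simp
qed

text \<open>
  The window consists of \<open>q\<close> full blocks, each costing its inner correlation and a junction, and of
  \<open>r\<close> further terms, each costing a junction only because \<open>g 0 = 0\<close>.
\<close>

lemma rs_window_corr_bound:
  assumes rs: "rs_sequence s a" and g0: "g 0 = 0"
    and K: "\<And>b m n. (\<And>n. norm (b n) \<le> 1) \<Longrightarrow> norm (cross_corr g b m n) \<le> K"
  shows "norm (window_corr g a (2 ^ k * q + r)) \<le> 2 * K * real q + K * real r"
proof -
  have a1: "norm (a n) \<le> 1" for n
  proof -
    have "a n \<in> {1, -1}" using rs by (auto simp: rs_sequence_def)
    then show ?thesis by auto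
  qed
  note P = rs_window_corr_partner[of s a g K k, OF rs g0 K]
  have nrm: "norm (window_corr g (rs_partner a k) (2 ^ k)) = norm (window_corr g a (2 ^ k))"
    using P by (metis add_eq_0_iff norm_minus_cancel)
  have block: "norm (window_corr g (\<lambda>r. a (2 ^ k * q + r)) (2 ^ k)) \<le> K" for q
  proof -
    obtain u where u: "u \<in> {1, -1}" and
      "(\<forall>r<2 ^ k. a (2 ^ k * q + r) = u * a r) \<or>
       (\<forall>r<2 ^ k. a (2 ^ k * q + r) = u * rs_partner a k r)"
      using rs_block[OF rs, of k q] by blast
    then have "window_corr g (\<lambda>r. a (2 ^ k * q + r)) (2 ^ k) \<in>
      {window_corr g a (2 ^ k), window_corr g (rs_partner a k) (2 ^ k)}"
      using window_corr_sign[OF u, of "2 ^ k" "\<lambda>r. a (2 ^ k * q + r)"] by blast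
    then show ?thesis using P nrm by auto
  qed
  have full: "norm (window_corr g a (2 ^ k * q)) \<le> 2 * K * real q" for q
  proof (induction q)
    case 0
    then show ?case by (simp add: window_corr_def)
  next
    case (Suc q)
    have "norm (window_corr g a (2 ^ k * Suc q)) \<le>
      norm (window_corr g a (2 ^ k * q)) + norm (window_corr g (\<lambda>r. a (2 ^ k * q + r)) (2 ^ k))
       + norm (cross_corr g a (2 ^ k * q) (2 ^ k))"
      unfolding mult_Suc_right add.commute[of "2 ^ k" "2 ^ k * q"] window_corr_add
      by (intro order_trans[OF norm_triangle_ineq] add_right_mono norm_triangle_ineq)
    also have "\<dots> \<le> 2 * K * real q + K + K"
      by (intro add_mono Suc.IH block K a1)
    finally show ?case by (simp add: algebra_simps)
  qed
  show ?thesis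
  proof (induction r)
    case 0
    then show ?case using full by simp
  next
    case (Suc r)
    have "norm (window_corr g a (2 ^ k * q + Suc r)) \<le>
       norm (window_corr g a (2 ^ k * q + r)) + norm (cross_corr g a (2 ^ k * q + r) 1)"
    proof -
      have "window_corr g a (2 ^ k * q + Suc r) =
        window_corr g a (2 ^ k * q + r) + cross_corr g a (2 ^ k * q + r) 1"
        using window_corr_add[of g a "2 ^ k * q + r" 1] g0 by (simp add: window_corr_def)
      then show ?thesis by (simp add: norm_triangle_ineq)
    qed
    also have "\<dots> \<le> (2 * K * real q + K * real r) + K"
      by (intro add_mono Suc.IH K a1)
    finally show ?case by (simp add: algebra_simps)
  qed
qed

lemma rs_window_corr_tendsto_0:
  assumes rs: "rs_sequence s a" and g0: "g 0 = 0"
    and supp: "\<And>z. \<bar>z\<bar> \<ge> int D \<Longrightarrow> g z = 0" and B: "\<And>z. norm (g z) \<le> B"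
  shows "(\<lambda>N. window_corr g a N / of_nat N) \<longlonglongrightarrow> 0"
proof (rule LIMSEQ_I)
  fix e :: real assume e: "e > 0"
  define K where "K = 2 * B * real D ^ 2"
  have "B \<ge> 0" using norm_ge_zero order_trans B by blast
  then have K0: "K \<ge> 0" by (simp add: K_def)
  have K: "norm (cross_corr g b m n) \<le> K" if "\<And>n. norm (b n) \<le> 1" for b m n
    unfolding K_def by (rule norm_cross_corr_le) (use that B supp in auto)
  \<comment> \<open>The full blocks contribute at most \<open>2 * K * N / 2 ^ k\<close> and the incomplete one at most \<open>K * 2 ^ k\<close>;
    \<open>k\<close> makes the former small relative to \<open>N\<close>, and then \<open>M\<close> the latter.\<close>
  obtain k :: nat where k: "4 * K / e < 2 ^ k"
    using real_arch_pow[of 2 "4 * K / e"] by auto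
  obtain M :: nat where M: "2 * K * 2 ^ k / e < real M" using reals_Archimedean2 by blast
  show "\<exists>no. \<forall>N\<ge>no. norm (window_corr g a N / of_nat N - 0) < e"
  proof (intro exI allI impI)
    fix N assume N: "N \<ge> Suc M"
    define q r where "q = N div 2 ^ k" and "r = N mod 2 ^ k"
    have Nqr: "N = 2 ^ k * q + r" by (simp add: q_def r_def)
    have r: "r \<le> 2 ^ k" by (simp add: r_def less_imp_le)
    have "norm (window_corr g a N) \<le> 2 * K * real q + K * real r"
      unfolding Nqr by (rule rs_window_corr_bound[OF rs g0 K])
    also have "\<dots> < e / 2 * real N + e / 2 * real N"
    proof (rule add_le_less_mono)
      have "2 * K * real q \<le> (e / 2 * 2 ^ k) * real q"
        using k e by (intro mult_right_mono) (auto simp: field_simps)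
      also have "\<dots> = e / 2 * real (2 ^ k * q)" by simp
      also have "\<dots> \<le> e / 2 * real N"
        using e by (intro mult_left_mono of_nat_mono) (auto simp: Nqr)
      finally show "2 * K * real q \<le> e / 2 * real N" .
      have "real r \<le> 2 ^ k" using r by (metis of_nat_le_iff of_nat_numeral of_nat_power)
      then have "K * real r \<le> K * 2 ^ k" using K0 by (intro mult_left_mono)
      also have "\<dots> < e / 2 * real M" using M e by (simp add: field_simps)
      also have "\<dots> \<le> e / 2 * real N" using e N by (intro mult_left_mono) auto
      finally show "K * real r < e / 2 * real N" .
    qed
    finally show "norm (window_corr g a N / of_nat N - 0) < e"
      using N by (simp add: norm_divide field_simps)
  qed
qed

text \<open>
  Adding the two recursions gives \<open>P\<^bsub>k+1\<^esub> + Q\<^bsub>k+1\<^esub> = 2 P\<^sub>k\<close>. As \<open>P\<^sub>k\<close> is the beginning of \<open>P\<^bsub>k+1\<^esub>\<close>, this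
  expresses the coefficients of every \<open>Q\<^sub>k\<close> by \<open>\<epsilon>\<close>.
\<close>

lemma rs_sequence_of_polynomials:
  fixes \<sigma> \<epsilon> :: "nat \<Rightarrow> int" and P Q :: "nat \<Rightarrow> int poly"
  assumes \<sigma>: "\<And>k. \<sigma> k \<in> {1, -1}"
    and "P 0 = [:0, 1:]" and Q0: "Q 0 = [:0, 1:]"
    and PS: "\<And>k. P (Suc k) = P k + smult (\<sigma> k) (monom 1 (2 ^ k) * Q k)"
    and QS: "\<And>k. Q (Suc k) = P k - smult (\<sigma> k) (monom 1 (2 ^ k) * Q k)"
    and \<epsilon>: "\<And>n. n \<ge> 1 \<Longrightarrow> \<epsilon> n \<in> {1, -1}"
    and P: "\<And>k. P k = (\<Sum>n=1..2 ^ k. monom (\<epsilon> n) n)"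
  shows "rs_sequence (\<lambda>k. of_int (\<sigma> k)) (\<lambda>n. of_int (\<epsilon> (Suc n)))"
proof -
  have cP: "coeff (P k) n = (if 1 \<le> n \<and> n \<le> 2 ^ k then \<epsilon> n else 0)" for k n
    unfolding P coeff_sum coeff_monom by auto
  have \<epsilon>1: "\<epsilon> (Suc 0) = 1"
    using cP[of 0 1] assms(2) by simp
  have cQ: "coeff (Q k) (Suc j) = (if 2 * j < 2 ^ k then \<epsilon> (Suc j) else - \<epsilon> (Suc j))"
    if "j < 2 ^ k" for k j
  proof (cases k)
    case 0
    then show ?thesis using that by (simp add: Q0 \<epsilon>1)
  next
    case (Suc l)
    have "P k + Q k = P l + P l" by (simp add: Suc PS QS)
    then have "coeff (P k) (Suc j) + coeff (Q k) (Suc j) = 2 * coeff (P l) (Suc j)"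
      by (metis coeff_add mult_2)
    then show ?thesis using that unfolding cP Suc by (auto split: if_splits)
  qed
  have main: "\<epsilon> (Suc (2 ^ k + j)) = \<sigma> k * (if 2 * j < 2 ^ k then \<epsilon> (Suc j) else - \<epsilon> (Suc j))"
    if j: "j < 2 ^ k" for k j
  proof -
    have "\<epsilon> (Suc (2 ^ k + j)) = coeff (P (Suc k)) (Suc (2 ^ k + j))"
      using j by (simp add: cP)
    also have "\<dots> = \<sigma> k * coeff (Q k) (Suc j)"
      unfolding PS by (simp add: cP coeff_monom_mult)
    finally show ?thesis using cQ[OF j] by simp
  qed
  have "of_int (\<sigma> k) \<in> {1, -1 :: complex}" for k using \<sigma>[of k] by auto
  moreover have "of_int (\<epsilon> (Suc n)) \<in> {1, -1 :: complex}" for n using \<epsilon>[of "Suc n"] by auto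
  ultimately show ?thesis
    unfolding rs_sequence_def using main by (auto simp: rs_partner_def)
qed

section \<open>Continuous functions of compact support\<close>

lemma CcI:
  assumes "continuous_on UNIV f" and "\<And>x. \<bar>x\<bar> \<ge> R \<Longrightarrow> f x = 0"
  shows "f \<in> Cc"
proof -
  have "{x. f x \<noteq> 0} \<subseteq> {-R..R}" using assms(2) by (force simp: not_le)
  then have "bounded {x. f x \<noteq> 0}" using bounded_subset bounded_closed_interval by blast
  then show ?thesis using assms(1) by (simp add: Cc_def compact_closure)
qed

lemma Cc_continuous: "f \<in> Cc \<Longrightarrow> continuous_on UNIV f"
  by (simp add: Cc_def)

lemma Cc_support:
  assumes "f \<in> Cc"
  obtains R where "R > 0" "\<And>x. \<bar>x\<bar> \<ge> R \<Longrightarrow> f x = 0"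
proof -
  have "bounded {x. f x \<noteq> 0}" using assms by (simp add: Cc_def compact_closure)
  then obtain b where "b > 0" "\<And>x. f x \<noteq> 0 \<Longrightarrow> \<bar>x\<bar> \<le> b"
    by (auto simp: bounded_pos)
  then show ?thesis by (intro that[of "b + 1"]) force+
qed

lemma Cc_bounded:
  assumes "f \<in> Cc"
  obtains B where "\<And>x. norm (f x) \<le> B"
proof -
  obtain R where R: "R > 0" "\<And>x. \<bar>x\<bar> \<ge> R \<Longrightarrow> f x = 0" using Cc_support[OF assms] by metis
  have "compact (f ` {-R..R})"
    using continuous_on_subset[OF Cc_continuous[OF assms]] by (intro compact_continuous_image) auto
  then obtain B where B: "B > 0" "\<And>x. x \<in> {-R..R} \<Longrightarrow> norm (f x) \<le> B"
    by (auto dest!: compact_imp_bounded simp: bounded_pos)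
  have "norm (f x) \<le> B" for x
    using B(2)[of x] R(2)[of x] B(1) by (cases "x \<in> {-R..R}") auto
  then show ?thesis by (rule that)
qed

lemma integrable_lborel_compact_support:
  fixes F :: "'a::euclidean_space \<Rightarrow> complex"
  assumes "continuous_on UNIV F" "compact K" "\<And>x. x \<notin> K \<Longrightarrow> F x = 0"
  shows "integrable lborel F"
proof -
  have "integrable lborel (\<lambda>x. indicator K x *\<^sub>R F x)"
    using continuous_on_subset[OF assms(1)] by (intro borel_integrable_compact assms) auto
  also have "(\<lambda>x. indicator K x *\<^sub>R F x) = F"
    using assms(3) by (auto simp: indicator_def)
  finally show ?thesis .
qed

lemma Cc_integrable:
  assumes "f \<in> Cc" shows "integrable lborel f"
proof -
  obtain R where R: "R > 0" "\<And>x. \<bar>x\<bar> \<ge> R \<Longrightarrow> f x = 0" using Cc_support[OF assms] by metis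
  show ?thesis
    by (rule integrable_lborel_compact_support[of _ "{-R..R}"]) (use R assms in \<open>auto simp: Cc_continuous\<close>)
qed

lemma Cc_measurable: "f \<in> Cc \<Longrightarrow> f \<in> borel_measurable borel"
  by (intro borel_measurable_continuous_onI Cc_continuous)

lemma Cc_add: assumes "f \<in> Cc" "g \<in> Cc" shows "(\<lambda>x. f x + g x) \<in> Cc"
proof -
  obtain R where R: "\<And>x. \<bar>x\<bar> \<ge> R \<Longrightarrow> f x = 0" using Cc_support[OF assms(1)] by metis
  obtain S where S: "\<And>x. \<bar>x\<bar> \<ge> S \<Longrightarrow> g x = 0" using Cc_support[OF assms(2)] by metis
  show ?thesis
  proof (rule CcI[of _ "max R S"])
    show "continuous_on UNIV (\<lambda>x. f x + g x)"
      by (intro continuous_on_add Cc_continuous assms)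
  qed (use R S in auto)
qed

lemma Cc_cmult: assumes "f \<in> Cc" shows "(\<lambda>x. c * f x) \<in> Cc"
proof -
  obtain R where R: "\<And>x. \<bar>x\<bar> \<ge> R \<Longrightarrow> f x = 0" using Cc_support[OF assms(1)] by metis
  show ?thesis
  proof (rule CcI[of _ R])
    show "continuous_on UNIV (\<lambda>x. c * f x)"
      by (intro continuous_on_mult_left Cc_continuous assms)
  qed (use R in auto)
qed

lemma Cc_translate: assumes "f \<in> Cc" shows "(\<lambda>x. f (x - u)) \<in> Cc"
proof -
  obtain R where R: "\<And>x. \<bar>x\<bar> \<ge> R \<Longrightarrow> f x = 0" using Cc_support[OF assms(1)] by metis
  show ?thesis
  proof (rule CcI[of _ "R + \<bar>u\<bar>"])
    show "continuous_on UNIV (\<lambda>x. f (x - u))"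
      by (rule continuous_on_compose2[OF Cc_continuous[OF assms]]) (auto intro!: continuous_intros)
  qed (rule R, linarith)
qed

lemma Cc_fun_tilde: assumes "f \<in> Cc" shows "fun_tilde f \<in> Cc"
proof -
  obtain R where R: "\<And>x. \<bar>x\<bar> \<ge> R \<Longrightarrow> f x = 0" using Cc_support[OF assms(1)] by metis
  have "continuous_on UNIV (\<lambda>x. f (- x))"
    by (rule continuous_on_compose2[OF Cc_continuous[OF assms]]) (auto intro!: continuous_intros)
  then show ?thesis
    unfolding fun_tilde_def[abs_def]
    by (intro CcI[of _ R] continuous_intros) (use R in auto)
qed

lemma Cc_fun_conv: assumes f: "f \<in> Cc" and g: "g \<in> Cc" shows "fun_conv f g \<in> Cc"
proof -
  obtain R where R: "\<And>x. \<bar>x\<bar> \<ge> R \<Longrightarrow> f x = 0" using Cc_support[OF f] by metis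
  obtain S where S: "\<And>x. \<bar>x\<bar> \<ge> S \<Longrightarrow> g x = 0" using Cc_support[OF g] by metis
  obtain B where B: "\<And>x. norm (g x) \<le> B" using Cc_bounded[OF g] by metis
  have [measurable]: "f \<in> borel_measurable borel" "g \<in> borel_measurable borel"
    using f g by (auto intro: Cc_measurable)
  show ?thesis
  proof (rule CcI[of _ "R + S"])
    show "continuous_on UNIV (fun_conv f g)"
      unfolding continuous_on_sequentially comp_def fun_conv_def
    proof (intro allI ballI impI)
      fix X :: "nat \<Rightarrow> real" and x
      assume "(\<forall>n. X n \<in> UNIV) \<and> X \<longlonglongrightarrow> x"
      then have X: "X \<longlonglongrightarrow> x" ..
      show "(\<lambda>n. LINT y|lborel. f y * g (X n - y)) \<longlonglongrightarrow> (LINT y|lborel. f y * g (x - y))"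
      proof (rule integral_dominated_convergence)
        show "integrable lborel (\<lambda>y. norm (f y) * B)"
          using Cc_integrable[OF f] by auto
        show "AE y in lborel. (\<lambda>n. f y * g (X n - y)) \<longlonglongrightarrow> f y * g (x - y)"
          by (intro AE_I2 tendsto_mult tendsto_const
              continuous_on_tendsto_compose[OF Cc_continuous[OF g]] tendsto_diff X) auto
        show "AE y in lborel. norm (f y * g (X n - y)) \<le> norm (f y) * B" for n
          by (intro AE_I2) (simp add: norm_mult mult_left_mono B)
      qed auto
    qed
    fix x assume x: "R + S \<le> \<bar>x\<bar>"
    have "f y * g (x - y) = 0" for y
    proof (cases "\<bar>y\<bar> \<ge> R")
      case False
      then have "\<bar>x - y\<bar> \<ge> S" using x by linarith
      then show ?thesis using S by simp
    qed (use R in simp)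
    then have "(\<lambda>y. f y * g (x - y)) = (\<lambda>_. 0)" by blast
    then show "fun_conv f g x = 0" by (simp only: fun_conv_def) simp
  qed
qed

section \<open>The Fourier transform of test functions\<close>

lemma inv_fourier_iexp: "inv_fourier f t = (CLINT x|lborel. iexp (2 * pi * t * x) * f x)"
  unfolding inv_fourier_def by (intro Bochner_Integration.integral_cong refl) (simp add: mult_ac)

lemma integrable_iexp_mult:
  fixes f :: "real \<Rightarrow> complex"
  assumes "integrable lborel f" shows "integrable lborel (\<lambda>x. iexp (c * x) * f x)"
  by (rule Bochner_Integration.integrable_bound[OF assms]) (use assms in \<open>auto simp: norm_mult\<close>)

lemma inv_fourier_measurable [measurable]:
  assumes "f \<in> Cc" shows "inv_fourier f \<in> borel_measurable borel"
proof -
  have [measurable]: "f \<in> borel_measurable borel" by (rule Cc_measurable[OF assms])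
  show ?thesis unfolding inv_fourier_iexp[abs_def] by measurable
qed

lemma inv_fourier_add:
  assumes "f \<in> Cc" "g \<in> Cc"
  shows "inv_fourier (\<lambda>x. f x + g x) t = inv_fourier f t + inv_fourier g t"
  unfolding inv_fourier_iexp distrib_left
  by (intro Bochner_Integration.integral_add integrable_iexp_mult Cc_integrable assms)

lemma inv_fourier_cmult: "inv_fourier (\<lambda>x. c * f x) t = c * inv_fourier f t"
  unfolding inv_fourier_iexp by (simp add: mult.left_commute[of _ c])

lemma inv_fourier_translate:
  "inv_fourier (\<lambda>x. f (x - u)) t = iexp (2 * pi * t * u) * inv_fourier f t"
proof -
  have "inv_fourier (\<lambda>x. f (x - u)) t = (CLINT x|lborel. iexp (2 * pi * t * (u + 1 * x)) * f (u + 1 * x - u))"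
    unfolding inv_fourier_iexp
    by (subst lborel_integral_real_affine[where c = 1 and t = u]) auto
  also have "\<dots> = (CLINT x|lborel. iexp (2 * pi * t * u) * (iexp (2 * pi * t * x) * f x))"
    by (intro Bochner_Integration.integral_cong refl)
       (simp add: mult.assoc[symmetric] exp_add[symmetric] distrib_left)
  finally show ?thesis by (simp add: inv_fourier_iexp)
qed

lemma inv_fourier_fun_tilde: "inv_fourier (fun_tilde f) t = cnj (inv_fourier f t)"
proof -
  have "cnj (inv_fourier f t) = (CLINT x|lborel. cnj (iexp (2 * pi * t * x) * f x))"
    unfolding inv_fourier_iexp by (rule Bochner_Integration.integral_cnj[symmetric])
  also have "\<dots> = (CLINT x|lborel. cnj (iexp (2 * pi * t * (0 + -1 * x)) * f (0 + -1 * x)))"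
    by (subst lborel_integral_real_affine[where c = "-1" and t = 0]) auto
  also have "\<dots> = inv_fourier (fun_tilde f) t"
    unfolding inv_fourier_iexp
    by (intro Bochner_Integration.integral_cong refl) (simp add: fun_tilde_def exp_cnj)
  finally show ?thesis by simp
qed

lemma inv_fourier_fun_conv:
  assumes f: "f \<in> Cc" and g: "g \<in> Cc"
  shows "inv_fourier (fun_conv f g) t = inv_fourier f t * inv_fourier g t"
proof -
  let ?e = "\<lambda>x. iexp (2 * pi * t * x)"
  obtain R where R: "\<And>x. \<bar>x\<bar> \<ge> R \<Longrightarrow> f x = 0" using Cc_support[OF f] by metis
  obtain S where S: "\<And>x. \<bar>x\<bar> \<ge> S \<Longrightarrow> g x = 0" using Cc_support[OF g] by metis
  define F where "F = (\<lambda>x y. ?e x * (f y * g (x - y)))"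
  have int: "integrable (lborel \<Otimes>\<^sub>M lborel) (case_prod F)"
    unfolding lborel_prod
  proof (rule integrable_lborel_compact_support)
    show "continuous_on UNIV (case_prod F)"
      unfolding F_def case_prod_beta
      by (intro continuous_intros continuous_on_compose2[OF Cc_continuous[OF f]]
          continuous_on_compose2[OF Cc_continuous[OF g]]) auto
    show "compact ({-(R + S)..R + S} \<times> {-R..R})" by (intro compact_Times) auto
    fix p assume p: "p \<notin> {-(R + S)..R + S} \<times> {-R..R}"
    obtain x y where xy: "p = (x, y)" by fastforce
    show "case_prod F p = 0"
    proof (cases "\<bar>y\<bar> \<ge> R")
      case False
      then have "\<bar>x - y\<bar> \<ge> S" using p xy by auto
      then show ?thesis using S by (simp add: F_def xy)
    qed (use R in \<open>simp add: F_def xy\<close>)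
  qed
  have "inv_fourier (fun_conv f g) t = (CLINT x|lborel. CLINT y|lborel. F x y)"
    unfolding inv_fourier_iexp fun_conv_def F_def by simp
  also have "\<dots> = (CLINT y|lborel. CLINT x|lborel. F x y)"
    by (rule lborel_pair.Fubini_integral[OF int, symmetric])
  also have "\<dots> = (CLINT y|lborel. (?e y * f y) * inv_fourier g t)"
  proof (intro Bochner_Integration.integral_cong refl)
    fix y
    have "(CLINT x|lborel. F x y) = f y * inv_fourier (\<lambda>x. g (x - y)) t"
      unfolding F_def inv_fourier_iexp by (simp add: mult.left_commute[of _ "f y"])
    then show "(CLINT x|lborel. F x y) = (?e y * f y) * inv_fourier g t"
      by (simp add: inv_fourier_translate)
  qed
  also have "\<dots> = inv_fourier f t * inv_fourier g t"
    unfolding inv_fourier_iexp[of f] by simp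
  finally show ?thesis .
qed

section \<open>Fourier inversion and Plancherel\<close>

lemma gaussian_fourier:
  "(CLINT u|lborel. of_real (std_normal_density u) * iexp (t * u)) = of_real (exp (- (t^2) / 2))"
proof -
  have "char std_normal_distribution t = (CLINT u|lborel. std_normal_density u *\<^sub>R iexp (t * u))"
    unfolding char_def by (intro integral_density) auto
  then show ?thesis by (simp add: char_std_normal_distribution scaleR_conv_of_real)
qed

text \<open>
  The Gaussian makes the double integral of \<open>iexp (2 * pi * t * x) * h x\<close> absolutely convergent, and
  integrating over \<open>t\<close> first gives a Gaussian in \<open>x\<close> that concentrates at the origin as \<open>r\<close> grows.
\<close>

lemma gaussian_fubini:
  assumes h: "h \<in> Cc" and r: "r > 0"
  shows "(CLINT t|lborel. inv_fourier h t * of_real (exp (- ((t / r)^2) / 2))) =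
         (CLINT y|lborel. h (y / (2 * pi * r)) * of_real (std_normal_density y))"
proof -
  let ?D = std_normal_density
  let ?G = "\<lambda>t. exp (- ((t / r)^2) / 2) :: real"
  have G: "?G t = sqrt (2 * pi) * ?D (t / r)" for t
    by (simp add: std_normal_density_def)
  have [measurable]: "h \<in> borel_measurable borel" by (rule Cc_measurable[OF h])
  have intD: "integrable lborel ?D" by (simp add: integrable_normal_density)
  have "integrable lborel (\<lambda>t. ?D (0 + (1 / r) * t))"
    using r by (intro lborel_integrable_real_affine intD) auto
  then have intG: "integrable lborel ?G" unfolding G by simp
  have int: "integrable (lborel \<Otimes>\<^sub>M lborel) (\<lambda>(t, x). iexp (2 * pi * t * x) * h x * of_real (?G t))"
  proof (rule lborel_pair.Fubini_integrable)
    show "(\<lambda>(t, x). iexp (2 * pi * t * x) * h x * of_real (?G t)) \<in> borel_measurable (lborel \<Otimes>\<^sub>M lborel)"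
      by measurable
    show "integrable lborel (\<lambda>t. LINT x|lborel. norm (case (t, x) of (t, x) \<Rightarrow> iexp (2 * pi * t * x) * h x * of_real (?G t)))"
      using intG by (simp add: norm_mult)
    show "AE t in lborel. integrable lborel (\<lambda>x. case (t, x) of (t, x) \<Rightarrow> iexp (2 * pi * t * x) * h x * of_real (?G t))"
      unfolding prod.case by (intro AE_I2 integrable_mult_left integrable_iexp_mult Cc_integrable h)
  qed
  have inner: "(CLINT t|lborel. iexp (2 * pi * t * x) * h x * of_real (?G t)) =
      of_real (2 * pi * r) * (h x * of_real (?D (2 * pi * r * x)))" for x
  proof -
    have Gu: "?G (0 + r * u) = sqrt (2 * pi) * ?D u" for u
      using G[of "0 + r * u"] r by simp
    have "(CLINT t|lborel. iexp (2 * pi * t * x) * h x * of_real (?G t)) =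
       r *\<^sub>R (CLINT u|lborel. iexp (2 * pi * (0 + r * u) * x) * h x * of_real (?G (0 + r * u)))"
      by (subst lborel_integral_real_affine[where c = r and t = 0]) (use r in auto)
    also have "(CLINT u|lborel. iexp (2 * pi * (0 + r * u) * x) * h x * of_real (?G (0 + r * u))) =
       (CLINT u|lborel. (h x * of_real (sqrt (2 * pi))) * (of_real (?D u) * iexp ((2 * pi * r * x) * u)))"
      unfolding Gu by (intro Bochner_Integration.integral_cong refl) (simp add: mult_ac)
    also have "\<dots> = (h x * of_real (sqrt (2 * pi))) * of_real (exp (- ((2 * pi * r * x)^2) / 2))"
      by (simp only: integral_mult_right_zero gaussian_fourier)
    also have "r *\<^sub>R \<dots> = of_real (2 * pi * r) * (h x * of_real (?D (2 * pi * r * x)))"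
    proof -
      have "sqrt (2 * pi) * exp (- ((2 * pi * r * x)^2) / 2) = (2 * pi) * ?D (2 * pi * r * x)"
        using real_sqrt_mult_self[of "2 * pi"] by (simp add: std_normal_density_def field_simps)
      then have "complex_of_real (sqrt (2 * pi)) * of_real (exp (- ((2 * pi * r * x)^2) / 2)) =
        of_real (2 * pi) * of_real (?D (2 * pi * r * x))"
        unfolding of_real_mult[symmetric] by simp
      then show ?thesis by (simp add: scaleR_conv_of_real mult.assoc mult.left_commute[of _ "h x"])
    qed
    finally show ?thesis .
  qed
  have "(CLINT t|lborel. inv_fourier h t * of_real (?G t)) =
        (CLINT t|lborel. CLINT x|lborel. iexp (2 * pi * t * x) * h x * of_real (?G t))"
    unfolding inv_fourier_iexp by simp
  also have "\<dots> = (CLINT x|lborel. CLINT t|lborel. iexp (2 * pi * t * x) * h x * of_real (?G t))"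
    by (rule lborel_pair.Fubini_integral[OF int, symmetric])
  also have "\<dots> = (2 * pi * r) *\<^sub>R (CLINT x|lborel. h x * of_real (?D (2 * pi * r * x)))"
    unfolding inner by (simp add: scaleR_conv_of_real)
  also have "\<dots> = (CLINT y|lborel. h (y / (2 * pi * r)) * of_real (?D y))"
    by (subst (2) lborel_integral_real_affine[where c = "2 * pi * r" and t = 0]) (use r in auto)
  finally show ?thesis .
qed

text \<open>
  As \<open>w\<close> is nonnegative, its Gaussian-damped integrals increase to its integral, finite or not. By
  \<open>gaussian_fubini\<close> they are averages of \<open>h\<close> against ever narrower Gaussians and tend to \<open>h 0\<close>, so
  the integral is finite after all.
\<close>

lemma fourier_inversion_at_0:
  assumes h: "h \<in> Cc" and w: "\<And>t. inv_fourier h t = of_real (w t)" and w0: "\<And>t. w t \<ge> 0"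
  shows "integrable lborel w" and "of_real (LINT t|lborel. w t) = h 0"
proof -
  let ?D = std_normal_density
  define G where "G = (\<lambda>n t. exp (- ((t / real (Suc n))^2) / 2) :: real)"
  define I where "I = (\<lambda>n. LINT t|lborel. w t * G n t)"
  have [measurable]: "h \<in> borel_measurable borel" by (rule Cc_measurable[OF h])
  have w_eq: "w = (\<lambda>t. Re (inv_fourier h t))" by (simp add: w)
  have wm [measurable]: "w \<in> borel_measurable borel"
    unfolding w_eq using inv_fourier_measurable[OF h] by measurable
  obtain B where B: "\<And>x. norm (h x) \<le> B" using Cc_bounded[OF h] by metis
  have intD: "integrable lborel ?D" by (simp add: integrable_normal_density)
  define A where "A = (LINT x|lborel. norm (h x))"
  have wA: "\<bar>w t\<bar> \<le> A" for t
  proof -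
    have "\<bar>w t\<bar> = norm (inv_fourier h t)" by (simp add: w)
    also have "\<dots> \<le> (LINT x|lborel. norm (iexp (2 * pi * t * x) * h x))"
      unfolding inv_fourier_iexp by (rule integral_norm_bound)
    finally show ?thesis by (simp add: norm_mult A_def)
  qed
  have intG: "integrable lborel (G n)" for n
  proof -
    have "integrable lborel (\<lambda>t. ?D (0 + (1 / real (Suc n)) * t))"
      by (intro lborel_integrable_real_affine intD) auto
    moreover have "G n = (\<lambda>t. sqrt (2 * pi) * ?D (0 + (1 / real (Suc n)) * t))"
      by (simp add: G_def std_normal_density_def)
    ultimately show ?thesis by simp
  qed
  have intwG: "integrable lborel (\<lambda>t. w t * G n t)" for n
  proof (rule Bochner_Integration.integrable_bound)
    show "integrable lborel (\<lambda>t. A * G n t)" using intG by simp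
    show "AE t in lborel. norm (w t * G n t) \<le> norm (A * G n t)"
      using wA by (intro AE_I2) (auto simp: abs_mult G_def intro: order_trans[OF wA])
  qed (simp add: G_def)
  have I: "of_real (I n) = (CLINT y|lborel. h (y / (2 * pi * real (Suc n))) * of_real (?D y))" for n
  proof -
    have "of_real (I n) = (CLINT t|lborel. inv_fourier h t * of_real (G n t))"
      unfolding I_def w of_real_mult[symmetric] by (rule integral_complex_of_real[symmetric])
    also have "\<dots> = (CLINT y|lborel. h (y / (2 * pi * real (Suc n))) * of_real (?D y))"
      unfolding G_def by (rule gaussian_fubini[OF h]) simp
    finally show ?thesis .
  qed
  have "(\<lambda>n. CLINT y|lborel. h (y / (2 * pi * real (Suc n))) * of_real (?D y))
      \<longlonglongrightarrow> (CLINT y|lborel. h 0 * of_real (?D y))"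
  proof (rule integral_dominated_convergence)
    show "integrable lborel (\<lambda>y. B * ?D y)" using intD by simp
    have "(\<lambda>n. y / (2 * pi * real (Suc n))) \<longlonglongrightarrow> 0" for y :: real
      by real_asymp
    then show "AE y in lborel. (\<lambda>n. h (y / (2 * pi * real (Suc n))) * of_real (?D y)) \<longlonglongrightarrow> h 0 * of_real (?D y)"
      by (intro AE_I2 tendsto_mult tendsto_const
          continuous_on_tendsto_compose[OF Cc_continuous[OF h]]) auto
    show "AE y in lborel. norm (h (y / (2 * pi * real (Suc n))) * of_real (?D y)) \<le> B * ?D y" for n
      by (intro AE_I2) (simp add: norm_mult mult_right_mono B)
  qed auto
  also have "(CLINT y|lborel. h 0 * of_real (?D y)) = h 0"
    by (simp add: integral_normal_density)
  finally have lim: "(\<lambda>n. complex_of_real (I n)) \<longlonglongrightarrow> h 0" unfolding I .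
  from tendsto_Re[OF this] have limI: "I \<longlonglongrightarrow> Re (h 0)" by simp
  have "h 0 = of_real (Re (h 0))"
    using LIMSEQ_unique[OF lim tendsto_of_real[OF limI]] .
  moreover have mono: "mono (\<lambda>n. w t * G n t)" for t
    unfolding G_def
    by (intro monoI mult_left_mono w0) (auto intro!: power_mono simp: power_divide frac_le)
  have Glim: "(\<lambda>n. G n t) \<longlonglongrightarrow> 1" for t
  proof -
    have "(\<lambda>n. t / real (Suc n)) \<longlonglongrightarrow> 0" by real_asymp
    then have "(\<lambda>n. G n t) \<longlonglongrightarrow> exp (- (0^2) / 2)" unfolding G_def by (intro tendsto_intros) auto
    then show ?thesis by simp
  qed
  have wlim: "(\<lambda>n. w t * G n t) \<longlonglongrightarrow> w t" for t using tendsto_mult_left[OF Glim, of "w t" t] by simp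
  note conv = integral_monotone_convergence_nonneg[OF intwG AE_I2[OF mono] AE_I2 AE_I2[OF wlim] limI[unfolded I_def]]
  have nn: "0 \<le> w t * G n t" for n t using w0 by (simp add: G_def)
  show "integrable lborel w" by (rule conv(1)) (use nn in auto)
  have "(LINT t|lborel. w t) = Re (h 0)" by (rule conv(2)) (use nn in auto)
  ultimately show "of_real (LINT t|lborel. w t) = h 0" by simp
qed

lemma inv_fourier_conv_tilde:
  assumes "f \<in> Cc"
  shows "inv_fourier (fun_conv f (fun_tilde f)) t = of_real ((norm (inv_fourier f t))\<^sup>2)"
  by (simp only: inv_fourier_fun_conv[OF assms Cc_fun_tilde[OF assms]] inv_fourier_fun_tilde complex_norm_square)

lemma lborel_fourier_transform_point_mass:
  assumes "\<And>f. f \<in> Cc \<Longrightarrow> \<gamma> f = f 0"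
  shows "is_fourier_transform \<gamma> lborel"
  unfolding is_fourier_transform_def
proof (intro conjI allI impI ballI)
  fix f assume f: "f \<in> Cc"
  have h: "fun_conv f (fun_tilde f) \<in> Cc" by (intro Cc_fun_conv Cc_fun_tilde f)
  note inv = fourier_inversion_at_0[OF h inv_fourier_conv_tilde[OF f]]
  show "integrable lborel (\<lambda>t. (norm (inv_fourier f t))\<^sup>2)" by (rule inv) auto
  show "\<gamma> (fun_conv f (fun_tilde f)) = of_real (LINT t|lborel. (norm (inv_fourier f t))\<^sup>2)"
    unfolding assms[OF h] by (rule inv(2)[symmetric]) auto
qed (use emeasure_lborel_cbox_finite emeasure_compact_finite in auto)


section \<open>Comparing two Fourier transforms of one functional\<close>

lemma norm_1_plus_iexp: "(norm (1 + iexp x))\<^sup>2 = 2 + 2 * cos x"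
proof -
  have "(norm (1 + iexp x))\<^sup>2 = (1 + cos x)\<^sup>2 + (sin x)\<^sup>2"
    by (simp add: cis_conv_exp[symmetric] cmod_def)
  also have "\<dots> = 1 + 2 * cos x + ((sin x)\<^sup>2 + (cos x)\<^sup>2)" by (simp add: power2_eq_square algebra_simps)
  finally show ?thesis by simp
qed

lemma norm_1_minus_i_iexp: "(norm (1 + - \<i> * iexp x))\<^sup>2 = 2 + 2 * sin x"
proof -
  have "(norm (1 + - \<i> * iexp x))\<^sup>2 = (1 + sin x)\<^sup>2 + (cos x)\<^sup>2"
    by (simp add: cis_conv_exp[symmetric] cmod_def)
  also have "\<dots> = 1 + 2 * sin x + ((sin x)\<^sup>2 + (cos x)\<^sup>2)" by (simp add: power2_eq_square algebra_simps)
  finally show ?thesis by simp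
qed

text \<open>
  Polarization. With \<open>T\<close> the translation by \<open>u = s / (2 * pi)\<close>, the transform of \<open>f + c * T f\<close> is that of
  \<open>f\<close> times \<open>1 + c * iexp (s * t)\<close>. The choices \<open>c = 1\<close> and \<open>c = - \<i>\<close> produce the cosine and the sine in
  the squared modulus, so both parts of the integral are combinations of values of \<open>\<gamma>\<close>.
\<close>

lemma fourier_transform_modulated_integral_unique:
  assumes \<nu>1: "is_fourier_transform \<gamma> \<nu>1" and \<nu>2: "is_fourier_transform \<gamma> \<nu>2" and f: "f \<in> Cc"
  shows "(CLINT t|\<nu>1. of_real ((norm (inv_fourier f t))\<^sup>2) * iexp (s * t)) =
         (CLINT t|\<nu>2. of_real ((norm (inv_fourier f t))\<^sup>2) * iexp (s * t))"
proof -
  let ?w = "\<lambda>t. (norm (inv_fourier f t))\<^sup>2"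
  define u where "u = s / (2 * pi)"
  define g1 g2 where "g1 = (\<lambda>x. f x + 1 * f (x - u))" and "g2 = (\<lambda>x. f x + - \<i> * f (x - u))"
  have g: "g1 \<in> Cc" "g2 \<in> Cc"
    unfolding g1_def g2_def by (intro Cc_add Cc_cmult Cc_translate f)+
  have hat: "inv_fourier (\<lambda>x. f x + c * f (x - u)) t = inv_fourier f t * (1 + c * iexp (s * t))" for c t
    by (simp add: inv_fourier_add[OF f Cc_cmult[OF Cc_translate[OF f]]] inv_fourier_cmult
        inv_fourier_translate u_def algebra_simps)
  have g1: "(norm (inv_fourier g1 t))\<^sup>2 = 2 * ?w t + 2 * (?w t * cos (s * t))" for t
    using norm_1_plus_iexp[of "s * t"] unfolding g1_def hat norm_mult power_mult_distrib
    by (simp add: algebra_simps)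
  have g2: "(norm (inv_fourier g2 t))\<^sup>2 = 2 * ?w t + 2 * (?w t * sin (s * t))" for t
    using norm_1_minus_i_iexp[of "s * t"] unfolding g2_def hat norm_mult power_mult_distrib
    by (simp add: algebra_simps)
  define J where "J = (\<lambda>f. Re (\<gamma> (fun_conv f (fun_tilde f))))"
  have "(CLINT t|\<nu>. of_real (?w t) * iexp (s * t)) =
     of_real (J g1 / 2 - J f) + \<i> * of_real (J g2 / 2 - J f)"
    if \<nu>: "is_fourier_transform \<gamma> \<nu>" for \<nu>
  proof -
    have int: "integrable \<nu> (\<lambda>t. (norm (inv_fourier g t))\<^sup>2)"
      and J: "J g = (LINT t|\<nu>. (norm (inv_fourier g t))\<^sup>2)" if "g \<in> Cc" for g
      using \<nu> that by (auto simp: is_fourier_transform_def J_def)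
    have e: "of_real (?w t) * iexp (s * t) =
        of_real ((norm (inv_fourier g1 t))\<^sup>2 / 2 - ?w t) + \<i> * of_real ((norm (inv_fourier g2 t))\<^sup>2 / 2 - ?w t)" for t
      unfolding g1 g2 by (simp add: complex_eq_iff Re_exp Im_exp field_simps)
    have split: "(CLINT t|\<nu>. of_real (a t) + \<i> * of_real (b t)) =
        of_real (LINT t|\<nu>. a t) + \<i> * of_real (LINT t|\<nu>. b t)"
      if "integrable \<nu> a" "integrable \<nu> b" for a b :: "real \<Rightarrow> real"
      using that by simp
    show ?thesis
      unfolding e J[OF f] J[OF g(1)] J[OF g(2)]
      by (subst split) (use int[OF f] int[OF g(1)] int[OF g(2)] in simp_all)
  qed
  from this[OF \<nu>1] this[OF \<nu>2] show ?thesis by simp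
qed

text \<open>
  The division by \<open>m\<close>, which is the total mass with respect to either measure, turns the weighted
  measures into probability measures, to which Levy's theorem applies.
\<close>

lemma fourier_transform_density_unique:
  assumes \<nu>1: "is_fourier_transform \<gamma> \<nu>1" and \<nu>2: "is_fourier_transform \<gamma> \<nu>2" and f: "f \<in> Cc"
    and m: "m = (LINT t|\<nu>1. (norm (inv_fourier f t))\<^sup>2)" "m \<noteq> 0"
  shows "density \<nu>1 (\<lambda>t. ennreal ((norm (inv_fourier f t))\<^sup>2 / m)) =
         density \<nu>2 (\<lambda>t. ennreal ((norm (inv_fourier f t))\<^sup>2 / m))"
proof -
  define w where "w = (\<lambda>t. (norm (inv_fourier f t))\<^sup>2 / m)"
  have m0: "m > 0" using m by (simp add: less_le)
  have w0: "w t \<ge> 0" for t using m0 by (simp add: w_def)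
  have wm [measurable]: "w \<in> borel_measurable borel"
    unfolding w_def using inv_fourier_measurable[OF f] by measurable
  have *: "real_distribution (density \<nu> w) \<and>
           char (density \<nu> w) s = (CLINT t|\<nu>. of_real ((norm (inv_fourier f t))\<^sup>2) * iexp (s * t)) / of_real m"
    if \<nu>: "is_fourier_transform \<gamma> \<nu>" for \<nu> s
  proof -
    have sets [measurable_cong]: "sets \<nu> = sets borel" using \<nu> by (simp add: is_fourier_transform_def)
    have int: "integrable \<nu> (\<lambda>t. (norm (inv_fourier f t))\<^sup>2)"
      and "of_real m = complex_of_real (LINT t|\<nu>. (norm (inv_fourier f t))\<^sup>2)"
      using \<nu> \<nu>1 f m(1) unfolding is_fourier_transform_def by (blast, metis)
    then have mv: "m = (LINT t|\<nu>. (norm (inv_fourier f t))\<^sup>2)" by (simp only: of_real_eq_iff)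
    have "emeasure (density \<nu> w) (space (density \<nu> w)) = (\<integral>\<^sup>+t. w t \<partial>\<nu>)"
      by (simp add: emeasure_density cong: nn_integral_cong)
    also have "\<dots> = ennreal (LINT t|\<nu>. w t)"
      using w0 int by (intro nn_integral_eq_integral) (auto simp: w_def)
    also have "(LINT t|\<nu>. w t) = 1" using mv m0 by (simp add: w_def)
    finally have "prob_space (density \<nu> w)" by (intro prob_spaceI) simp
    then have "real_distribution (density \<nu> w)"
      by (simp add: real_distribution_def real_distribution_axioms_def sets)
    moreover have "char (density \<nu> w) s = (CLINT t|\<nu>. w t *\<^sub>R iexp (s * t))"
      unfolding char_def using w0 by (intro integral_density) auto
    moreover have "w t *\<^sub>R iexp (s * t) = of_real ((norm (inv_fourier f t))\<^sup>2) * iexp (s * t) / of_real m" for t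
      by (simp add: w_def scaleR_conv_of_real)
    ultimately show ?thesis by simp
  qed
  have "density \<nu>1 w = density \<nu>2 w"
    using *[OF \<nu>1] *[OF \<nu>2] fourier_transform_modulated_integral_unique[OF \<nu>1 \<nu>2 f]
    by (intro Levy_uniqueness) (auto intro!: ext)
  then show ?thesis by (simp add: w_def)
qed

text \<open>
  The support \<open>\<bar>x\<bar> \<le> 1 / (4 * r)\<close> is chosen so that \<open>cos (2 * pi * t * x)\<close> is positive on its interior
  for all \<open>\<bar>t\<bar> < r\<close>.
\<close>

definition tent :: "real \<Rightarrow> real \<Rightarrow> complex" where
  "tent r x = of_real (max 0 (1 / (4 * r) - \<bar>x\<bar>))"

lemma tent_Cc: "tent r \<in> Cc"
  by (rule CcI[of _ "1 / (4 * r)"]) (auto simp: tent_def[abs_def] intro!: continuous_intros)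

lemma inv_fourier_tent_nonzero:
  assumes r: "r > 0" and t: "\<bar>t\<bar> < r"
  shows "inv_fourier (tent r) t \<noteq> 0"
proof
  assume 0: "inv_fourier (tent r) t = 0"
  define v where "v = (\<lambda>x. cos (2 * pi * t * x) * max 0 (1 / (4 * r) - \<bar>x\<bar>))"
  have v: "v x > 0" if x: "x \<in> {-(1 / (4 * r))<..<1 / (4 * r)}" for x
  proof -
    have "\<bar>t * x\<bar> < 1 / 4"
    proof (cases "x = 0")
      case False
      have "\<bar>t * x\<bar> < r * \<bar>x\<bar>" unfolding abs_mult using t False by (intro mult_strict_right_mono) auto
      also have "\<dots> \<le> r * (1 / (4 * r))" using x r by (intro mult_left_mono) auto
      finally show ?thesis using r by simp
    qed simp
    then have "2 * pi * \<bar>t * x\<bar> < 2 * pi * (1 / 4)" by (intro mult_strict_left_mono) auto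
    then have "\<bar>2 * pi * t * x\<bar> < pi / 2" by (simp add: abs_mult mult.assoc)
    then have "cos (2 * pi * t * x) > 0" by (intro cos_gt_zero_pi) linarith+
    then show ?thesis using x by (auto simp: v_def intro!: mult_pos_pos)
  qed
  have v0: "v x \<ge> 0" for x
  proof (cases "x \<in> {-(1 / (4 * r))<..<1 / (4 * r)}")
    case False
    then have "1 / (4 * r) - \<bar>x\<bar> \<le> 0" by auto
    then show ?thesis by (simp add: v_def)
  qed (use v in \<open>auto intro: less_imp_le\<close>)
  have int: "integrable lborel (\<lambda>x. iexp (2 * pi * t * x) * tent r x)"
    by (intro integrable_iexp_mult Cc_integrable tent_Cc)
  have v_eq: "v = (\<lambda>x. Re (iexp (2 * pi * t * x) * tent r x))"
    by (simp add: v_def tent_def Re_exp fun_eq_iff)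
  have intv: "integrable lborel v" unfolding v_eq by (rule integrable_Re[OF int])
  have "(LINT x|lborel. v x) = Re (inv_fourier (tent r) t)"
    unfolding v_eq inv_fourier_iexp by (rule integral_Re[OF int])
  then have "AE x in lborel. v x = 0"
    using integral_nonneg_eq_0_iff_AE[OF intv] v0 by (simp add: 0)
  then have "AE x in lborel. x \<notin> {-(1 / (4 * r))<..<1 / (4 * r)}"
    by eventually_elim (use v in fastforce)
  then have "{-(1 / (4 * r))<..<1 / (4 * r)} \<in> null_sets lborel"
    by (subst AE_iff_null_sets) auto
  then have "emeasure lborel {-(1 / (4 * r))<..<1 / (4 * r)} = 0" by auto
  then show False using r by simp
qed

text \<open>
  If \<open>A\<close> is null for \<open>\<nu>2\<close>, it is null for \<open>\<bar>f^\<bar>\<^sup>2 \<nu>2 = \<bar>f^\<bar>\<^sup>2 \<nu>1\<close>, so that \<open>f^\<close> vanishes \<open>\<nu>1\<close>-almost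
  everywhere on \<open>A\<close>. The tent functions form a countable family of such \<open>f\<close> whose transforms have
  no common zero.
\<close>

lemma fourier_transform_null_sets:
  assumes \<nu>1: "is_fourier_transform \<gamma> \<nu>1" and \<nu>2: "is_fourier_transform \<gamma> \<nu>2"
  shows "absolutely_continuous \<nu>2 \<nu>1"
  unfolding absolutely_continuous_def
proof
  fix A assume A: "A \<in> null_sets \<nu>2"
  have sets: "sets \<nu>1 = sets borel" "sets \<nu>2 = sets borel"
    using \<nu>1 \<nu>2 by (auto simp: is_fourier_transform_def)
  have A1: "A \<in> sets \<nu>1" using A sets by auto
  have *: "AE t in \<nu>1. t \<in> A \<longrightarrow> inv_fourier f t = 0" if f: "f \<in> Cc" for f
  proof -
    let ?w = "\<lambda>t. (norm (inv_fourier f t))\<^sup>2"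
    define m where "m = (LINT t|\<nu>1. ?w t)"
    have int: "integrable \<nu>1 ?w" using \<nu>1 f by (simp add: is_fourier_transform_def)
    have m0: "m \<ge> 0" by (simp add: m_def)
    have [measurable]: "inv_fourier f \<in> borel_measurable \<nu>1" "inv_fourier f \<in> borel_measurable \<nu>2"
      using inv_fourier_measurable[OF f] by (simp_all add: measurable_cong_sets[OF sets(1) refl] measurable_cong_sets[OF sets(2) refl])
    show ?thesis
    proof (cases "m = 0")
      case True
      then have "AE t in \<nu>1. ?w t = 0"
        unfolding m_def by (subst (asm) integral_nonneg_eq_0_iff_AE[OF int]) auto
      then show ?thesis by eventually_elim simp
    next
      case False
      have "A \<in> null_sets (density \<nu>2 (\<lambda>t. ennreal (?w t / m)))"
        using A absolutely_continuousI_density[of "\<lambda>t. ennreal (?w t / m)" \<nu>2]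
        unfolding absolutely_continuous_def by auto
      then have "A \<in> null_sets (density \<nu>1 (\<lambda>t. ennreal (?w t / m)))"
        by (simp add: fourier_transform_density_unique[OF \<nu>1 \<nu>2 f m_def False])
      then have "AE t in \<nu>1. t \<in> A \<longrightarrow> ennreal (?w t / m) = 0"
        by (subst (asm) null_sets_density_iff) auto
      then show ?thesis
        by eventually_elim (use m0 False in \<open>auto simp: ennreal_eq_0_iff divide_le_0_iff\<close>)
    qed
  qed
  have "AE t in \<nu>1. \<forall>n. t \<in> A \<longrightarrow> inv_fourier (tent (real (Suc n))) t = 0"
    unfolding AE_all_countable by (intro allI * tent_Cc)
  then have "AE t in \<nu>1. t \<notin> A"
  proof eventually_elim
    fix t assume 0: "\<forall>n. t \<in> A \<longrightarrow> inv_fourier (tent (real (Suc n))) t = 0"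
    obtain n :: nat where "\<bar>t\<bar> < real n" using reals_Archimedean2 by blast
    then have "inv_fourier (tent (real (Suc n))) t \<noteq> 0" by (intro inv_fourier_tent_nonzero) auto
    with 0 show "t \<notin> A" by blast
  qed
  then show "A \<in> null_sets \<nu>1"
    using A1 by (simp add: AE_iff_null_sets)
qed

section \<open>Autocorrelation and diffraction\<close>

text \<open>
  The pairs \<open>n = m\<close> contribute \<open>f 0\<close> each, \<open>N\<close> in total. All others form the correlation with weight
  \<open>g\<close>, the restriction of \<open>f\<close> to the integers with its value at zero removed.
\<close>

lemma finite_autocorrelation_tendsto_point_mass:
  assumes rs: "rs_sequence s (\<lambda>n. c (Suc n))" and f: "f \<in> Cc"
  shows "(\<lambda>N. finite_autocorrelation c N f) \<longlonglongrightarrow> f 0"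
proof -
  define a where "a = (\<lambda>n. c (Suc n))"
  define g where "g = (\<lambda>z::int. if z = 0 then 0 else f (real_of_int z))"
  have rs: "rs_sequence s a" using rs by (simp add: a_def)
  then have a: "a n = 1 \<or> a n = -1" for n by (auto simp: rs_sequence_def)
  obtain R where R: "\<And>x. \<bar>x\<bar> \<ge> R \<Longrightarrow> f x = 0" using Cc_support[OF f] by metis
  obtain B where B: "\<And>x. norm (f x) \<le> B" using Cc_bounded[OF f] by metis
  have B0: "B \<ge> 0" using norm_ge_zero order_trans B by blast
  obtain D :: nat where D: "R < real D" using reals_Archimedean2 by blast
  have "(\<lambda>N. window_corr g a N / of_nat N) \<longlonglongrightarrow> 0"
  proof (rule rs_window_corr_tendsto_0[OF rs, of g D B])
    fix z assume "int D \<le> \<bar>z\<bar>"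
    then have "real D \<le> \<bar>real_of_int z\<bar>" by linarith
    then show "g z = 0" using D by (auto simp: g_def intro!: R)
  qed (auto simp: g_def B B0)
  then have lim: "(\<lambda>N. window_corr g a N / of_nat N + f 0) \<longlonglongrightarrow> 0 + f 0"
    by (intro tendsto_intros)
  have eq: "finite_autocorrelation c N f = window_corr g a N / of_nat N + f 0" if N: "N > 0" for N
  proof -
    have summand: "a i * (cnj (a j) * f (real (Suc i) + - real (Suc j))) =
        a i * a j * g (int i - int j) + (if j = i then f 0 else 0)" for i j
      using a[of i] a[of j] by (auto simp: g_def)
    have "finite_autocorrelation c N f =
        1 / of_nat N * (\<Sum>i<N. \<Sum>j<N. a i * (cnj (a j) * f (real (Suc i) + - real (Suc j))))"
      unfolding finite_autocorrelation_def measure_conv_def finite_comb_def finite_comb_tilde_def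
        point_mass_def One_nat_def sum.atLeast1_atMost_eq a_def
      by (simp add: sum_distrib_left)
    also have "\<dots> = 1 / of_nat N * (window_corr g a N + of_nat N * f 0)"
      unfolding summand window_corr_def by (simp add: sum.distrib)
    finally show ?thesis using N by (simp add: field_simps)
  qed
  have "\<forall>\<^sub>F N in sequentially. window_corr g a N / of_nat N + f 0 = finite_autocorrelation c N f"
    using eventually_gt_at_top[of 0] by eventually_elim (simp add: eq)
  from Lim_transform_eventually[OF lim this] show ?thesis by simp
qed

lemma vague_accumulation_point_eq_limit:
  assumes "vague_accumulation_point \<mu> \<gamma>" and f: "f \<in> Cc" and lim: "(\<lambda>N. \<mu> N f) \<longlonglongrightarrow> l"
  shows "\<gamma> f = l"
proof (rule ccontr)
  assume "\<gamma> f \<noteq> l"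
  define e where "e = norm (\<gamma> f - l) / 2"
  have e: "e > 0" using \<open>\<gamma> f \<noteq> l\<close> by (simp add: e_def)
  have "\<exists>\<^sub>F N in sequentially. \<forall>f\<in>{f}. norm (\<mu> N f - \<gamma> f) < e"
    using assms(1) e f unfolding vague_accumulation_point_def by blast
  moreover have "\<forall>\<^sub>F N in sequentially. norm (\<mu> N f - l) < e"
    using tendstoD[OF lim e] by (simp add: dist_norm)
  ultimately have "\<exists>\<^sub>F N in sequentially.
      norm (\<mu> N f - l) < e \<and> (\<forall>f\<in>{f}. norm (\<mu> N f - \<gamma> f) < e)"
    by (rule frequently_eventually_conj)
  then obtain N where "norm (\<mu> N f - \<gamma> f) < e" "norm (\<mu> N f - l) < e"
    by (auto dest!: frequently_ex)
  then have "norm (\<gamma> f - l) < e + e"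
    using norm_diff_triangle_less[of "\<gamma> f" "\<mu> N f" e l e] by (simp add: norm_minus_commute)
  then show False by (simp add: e_def)
qed

theorem corollary3p3:
  fixes \<sigma> \<epsilon> :: "nat \<Rightarrow> int" and P Q :: "nat \<Rightarrow> int poly"
  assumes "\<And>k. \<sigma> k \<in> {1, -1}"
    and "P 0 = [:0, 1:]" and "Q 0 = [:0, 1:]"
    and "\<And>k. P (Suc k) = P k + smult (\<sigma> k) (monom 1 (2 ^ k) * Q k)"
    and "\<And>k. Q (Suc k) = P k - smult (\<sigma> k) (monom 1 (2 ^ k) * Q k)"
    and "\<And>n. n \<ge> 1 \<Longrightarrow> \<epsilon> n \<in> {1, -1}"
    and "\<And>k. P k = (\<Sum>n=1..2 ^ k. monom (\<epsilon> n) n)"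
  shows "purely_ac_diffraction (\<lambda>n. of_int (\<epsilon> n))"
  unfolding purely_ac_diffraction_def
proof (intro allI impI conjI)
  fix \<gamma> assume \<gamma>: "is_autocorrelation (\<lambda>n. of_int (\<epsilon> n)) \<gamma>"
  have rs: "rs_sequence (\<lambda>k. of_int (\<sigma> k)) (\<lambda>n. of_int (\<epsilon> (Suc n)))"
    by (rule rs_sequence_of_polynomials[OF assms])
  have "\<gamma> f = f 0" if "f \<in> Cc" for f
    using \<gamma> that finite_autocorrelation_tendsto_point_mass[OF rs that]
    unfolding is_autocorrelation_def by (rule vague_accumulation_point_eq_limit)
  then have lborel: "is_fourier_transform \<gamma> lborel"
    by (rule lborel_fourier_transform_point_mass)
  then show "\<exists>\<nu>. is_fourier_transform \<gamma> \<nu>" ..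
  fix \<nu> assume "is_fourier_transform \<gamma> \<nu>"
  then show "absolutely_continuous lborel \<nu>"
    by (rule fourier_transform_null_sets[OF _ lborel])
qed

end
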